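(* For an integer $m\ge 1$, let $a^+_m(n)$ (resp. $a^-_m(n)$) denote the number of partitions of $n$ with exactly $m$ parity blocks, the last parity block being positive (resp. negative). Then, as formal power series in $q$, \[ \sum_{n=1}^{\infty} a^+_m(n) q^n =(-1)^{m}+ \frac{(-1)^{m-1}}{(q;q)_{\infty}} \sum_{l=0}^{m-1}(-1)^{l} q^{\frac{l(3l+1)}{2}}(1-q^{2l+1}) \] and \[ \sum_{n=1}^{\infty} a^-_m(n) q^n =(-1)^{m}+ \frac{(-1)^{m-1}}{(q;q)_{\infty}} \sum_{l=0}^{m-1}(-1)^l q^{\frac{l(3l-1)}{2}}(1-q^{4l+2}). \]
   Context: Every partition $\lambda$ of $n$ is represented by its Frobenius symbol $\begin{pmatrix} x_1 & \cdots & x_d\\ y_1&\cdots & y_d\end{pmatrix}$, where $d$ is the number of cells on the main diagonal of the Ferrers diagram, $x_i$ (resp. $y_i$) is the number of cells in row $i$ to the right of (resp. in column $i$ below) the diagonal, so $x_1>\cdots>x_d\ge 0$, $y_1>\cdots>y_d\ge0$ and $\sum_{i=1}^d(x_i+y_i+1)=n$; $d$ is called the number of columns. Column $i$ is positive if $x_i-y_i\ge 1$ and negative if $x_i-y_i\le 0$. The parity blocks of $\lambda$ are the maximal sets of contiguous columns all having the same sign; a block is positive (resp. negative) if its columns are positive (resp. negative). Notation: $(a;q)_n=(1-a)(1-aq)\cdots(1-aq^{n-1})$ and $(a;q)_\infty=\prod_{k\ge0}(1-aq^k)$. *)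

theory Defs
  imports "HOL-Computational_Algebra.Formal_Power_Series"
begin

definition is_partition :: "nat list \<Rightarrow> nat \<Rightarrow> bool" where
  "is_partition lam n \<longleftrightarrow> sorted_wrt (\<ge>) lam \<and> (\<forall>p\<in>set lam. 0 < p) \<and> sum_list lam = n"

definition conj_part :: "nat list \<Rightarrow> nat \<Rightarrow> nat" where
  "conj_part lam j = length (filter (\<lambda>p. j \<le> p) lam)"

text \<open>Frobenius symbol: d = number of diagonal cells, x_i = lam_i - i, y_i = lam'_i - i (1-based).\<close>
definition frob_d :: "nat list \<Rightarrow> nat" where
  "frob_d lam = card {i \<in> {1..length lam}. i \<le> lam ! (i - 1)}"

definition frob_x :: "nat list \<Rightarrow> nat \<Rightarrow> nat" where
  "frob_x lam i = lam ! (i - 1) - i"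

definition frob_y :: "nat list \<Rightarrow> nat \<Rightarrow> nat" where
  "frob_y lam i = conj_part lam i - i"

definition col_positive :: "nat list \<Rightarrow> nat \<Rightarrow> bool" where
  "col_positive lam i \<longleftrightarrow> int (frob_x lam i) - int (frob_y lam i) \<ge> 1"

definition col_signs :: "nat list \<Rightarrow> bool list" where
  "col_signs lam = map (col_positive lam) [1..<frob_d lam + 1]"

text \<open>Parity blocks = maximal runs of equal signs.\<close>
definition num_blocks :: "nat list \<Rightarrow> nat" where
  "num_blocks lam = length (remdups_adj (col_signs lam))"

definition last_block_positive :: "nat list \<Rightarrow> bool" where
  "last_block_positive lam \<longleftrightarrow> col_signs lam \<noteq> [] \<and> last (col_signs lam)"

definition last_block_negative :: "nat list \<Rightarrow> bool" where
  "last_block_negative lam \<longleftrightarrow> col_signs lam \<noteq> [] \<and> \<not> last (col_signs lam)"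

definition a_plus :: "nat \<Rightarrow> nat \<Rightarrow> nat" where
  "a_plus m n = card {lam. is_partition lam n \<and> num_blocks lam = m \<and> last_block_positive lam}"

definition a_minus :: "nat \<Rightarrow> nat \<Rightarrow> nat" where
  "a_minus m n = card {lam. is_partition lam n \<and> num_blocks lam = m \<and> last_block_negative lam}"

definition qpoch_inf :: "rat fps" where
  "qpoch_inf = Abs_fps (\<lambda>n. fps_nth (\<Prod>k\<in>{1..n}. 1 - fps_X ^ k) n)"

end

theory Submission
  imports Defs
begin

text \<open>
  Let \<open>P\<close> count the partitions whose sequence of column signs contains an alternating subsequence
  of length \<open>m\<close> with prescribed last sign. The generating function of \<open>P\<close> is a single term
  \<open>q^(m(3m+1)/2) / (q;q)\<^sub>\<infinity>\<close> (last sign positive) or \<open>q^(m(3m-1)/2) / (q;q)\<^sub>\<infinity>\<close> (last sign negative),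
  and the sequences counted for \<open>m\<close> but not for \<open>m + 1\<close> with the opposite last sign are exactly those
  with \<open>m\<close> or \<open>m + 1\<close> blocks whose last block has the prescribed sign; the theorem follows by
  telescoping.

  The formula for \<open>P\<close> is a reflection principle. Read the entries of the Frobenius symbol from large to
  small, at equal values the bottom row first, as a walk that steps up at an \<open>x\<close> and down at
  a \<open>y\<close>. A column is positive iff the walk is above zero while the column is half read, so \<open>P\<close>
  counts walks from \<open>0\<close> to \<open>0\<close> hitting \<open>1\<close> and \<open>-1\<close> alternately \<open>m\<close> times. Walks with bounded
  entries and given endpoints are counted by \<open>q\<close>-binomial coefficients, whose symmetry says that
  reflecting the endpoint at \<open>\<plusminus>1\<close> only changes the weight by a power of \<open>q\<close>. Hence the walks
  alternately hitting \<open>\<plusminus>1\<close> and all walks to a reflected endpoint satisfy the same recursion.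
\<close>

section \<open>Gaussian binomial coefficients\<close>

definition qpoch :: "nat \<Rightarrow> rat fps" where
  "qpoch n = (\<Prod>k\<in>{1..n}. 1 - fps_X ^ k)"

lemma qpoch_0 [simp]: "qpoch 0 = 1"
  by (simp add: qpoch_def)

lemma qpoch_Suc: "qpoch (Suc n) = qpoch n * (1 - fps_X ^ Suc n)"
  by (simp add: qpoch_def)

lemma qpoch_nth_0 [simp]: "fps_nth (qpoch n) 0 = 1"
  by (induction n) (simp_all add: qpoch_Suc)

lemma qpoch_nz [simp]: "qpoch n \<noteq> 0"
  by (metis fps_zero_nth qpoch_nth_0 zero_neq_one)

text \<open>A factor \<open>1 - fps_X ^ Suc n\<close> leaves the coefficients up to \<open>n\<close>
  unchanged, so every long enough finite product agrees there with the infinite one.\<close>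

lemma qpoch_nth_stable: "k \<le> n \<Longrightarrow> fps_nth (qpoch n) k = fps_nth qpoch_inf k"
proof (induction n rule: dec_induct)
  case base
  show ?case by (simp add: qpoch_inf_def qpoch_def)
next
  case (step n)
  then show ?case
    by (simp add: qpoch_Suc algebra_simps fps_X_power_mult_right_nth del: power_Suc)
qed

text \<open>The lower index is an integer because it will encode the endpoint of a walk, which may
  lie out of reach.\<close>

definition qbinom :: "nat \<Rightarrow> int \<Rightarrow> rat fps" where
  "qbinom n k = (if 0 \<le> k \<and> k \<le> int n
     then qpoch n * inverse (qpoch (nat k) * qpoch (n - nat k)) else 0)"

lemma qbinom_symmetric: "qbinom n (int n - k) = qbinom n k"
proof (cases "0 \<le> k \<and> k \<le> int n")
  case True
  then obtain j where j: "k = int j" "j \<le> n" by (metis nonneg_int_cases of_nat_le_iff)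
  then have "nat (int n - k) = n - j" "n - (n - j) = j" by auto
  then show ?thesis using j by (simp add: qbinom_def mult.commute)
qed (auto simp: qbinom_def)

lemma qbinom_qpoch: "qbinom (a + b) (int a) * (qpoch a * qpoch b) = qpoch (a + b)"
proof -
  have "inverse (qpoch a * qpoch b) * (qpoch a * qpoch b) = 1"
    by (intro inverse_mult_eq_1) simp
  then show ?thesis by (simp add: qbinom_def mult.assoc)
qed

lemma qbinom_0 [simp]: "qbinom n 0 = 1" and qbinom_self [simp]: "qbinom n (int n) = 1"
proof -
  show "qbinom n (int n) = 1"
    using qbinom_qpoch[of n 0] by simp
  then show "qbinom n 0 = 1" using qbinom_symmetric[of n 0] by simp
qed

lemma qbinom_out [simp]: "k < 0 \<Longrightarrow> qbinom n k = 0" "k > int n \<Longrightarrow> qbinom n k = 0"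
  by (auto simp: qbinom_def)

text \<open>With \<open>k = a + 1\<close> and \<open>n = a + b + 1\<close>, clearing denominators
  leaves \<open>(1 - q^(a+1)) + q^(a+1) (1 - q^(b+1)) = 1 - q^(a+b+2)\<close>.\<close>

lemma qbinom_pascal:
  assumes "0 \<le> k"
  shows "qbinom (Suc n) k = qbinom n (k - 1) + fps_X ^ nat k * qbinom n k"
proof -
  obtain j where j: "k = int j" using assms by (metis nonneg_int_cases)
  consider "j = 0" | "j = Suc n" | "j > Suc n" | a b where "j = Suc a" "n = a + Suc b"
  proof -
    have "j = 0 \<or> j = Suc n \<or> j > Suc n \<or> (\<exists>a b. j = Suc a \<and> n = a + Suc b)"
      by presburger
    then show ?thesis using that by blast
  qed
  then show ?thesis
  proof cases
    case 4
    let ?Q = "qpoch (Suc a) * qpoch (Suc b)"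
    have 1: "qbinom (Suc n) k * ?Q = qpoch (Suc n)"
      using qbinom_qpoch[of "Suc a" "Suc b"] 4 j by simp
    have 2: "qbinom n (k - 1) * ?Q = qpoch n * (1 - fps_X ^ Suc a)"
      using qbinom_qpoch[of "a" "Suc b"] 4 j 
      by (simp add: qpoch_Suc[of a] algebra_simps del: power_Suc)
    have 3: "qbinom n k * ?Q = qpoch n * (1 - fps_X ^ Suc b)"
      using qbinom_qpoch[of "Suc a" "b"] 4 j 
      by (simp add: qpoch_Suc[of b] algebra_simps del: power_Suc)
    have "nat k = Suc a" using 4 j by simp
    have "(qbinom n (k - 1) + fps_X ^ nat k * qbinom n k) * ?Q =
        qpoch n * ((1 - fps_X ^ Suc a) + fps_X ^ Suc a * (1 - fps_X ^ Suc b))"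
      by (simp only: distrib_right mult.assoc 2 3 \<open>nat k = Suc a\<close>) (simp add: algebra_simps)
    also have "\<dots> = qpoch (Suc n)"
      using 4 by (simp add: qpoch_Suc algebra_simps power_add)
    finally have "(qbinom n (k - 1) + fps_X ^ nat k * qbinom n k) * ?Q = qbinom (Suc n) k * ?Q"
      using 1 by simp
    then show ?thesis by simp
  qed (use j qbinom_self[of "Suc n"] in auto)
qed

lemma qbinom_pascal':
  assumes "k \<le> int n + 1"
  shows "qbinom (Suc n) k = qbinom n k + fps_X ^ nat (int n + 1 - k) * qbinom n (k - 1)"
  using qbinom_pascal[of "int (Suc n) - k" n] qbinom_symmetric[of "Suc n" k]
    qbinom_symmetric[of n k] qbinom_symmetric[of n "k - 1"] assms
  by (simp add: algebra_simps)

text \<open>Modulo \<open>q^(n+1)\<close>, expressed by \<open>fps_cutoff (Suc n)\<close>, numerator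
  and both denominator factors equal the infinite product, so one copy of it remains in the
  denominator.\<close>

lemma qbinom_nth_limit:
  assumes "n \<le> a" "n \<le> b"
  shows "fps_nth (qbinom (a + b) (int a)) n = fps_nth (inverse qpoch_inf) n"
proof -
  have nz: "fps_nth qpoch_inf 0 = 1" by (simp add: qpoch_inf_def)
  define R where "R = inverse qpoch_inf"
  have R: "R * qpoch_inf = 1" unfolding R_def by (intro inverse_mult_eq_1) (simp add: nz)
  have "fps_cutoff (Suc n) (qpoch j) = fps_cutoff (Suc n) qpoch_inf" if "n \<le> j" for j
    using that by (auto simp: fps_eq_iff qpoch_nth_stable)
  then have c: "fps_cutoff (Suc n) (qpoch a) = fps_cutoff (Suc n) qpoch_inf"
     "fps_cutoff (Suc n) (qpoch b) = fps_cutoff (Suc n) qpoch_inf"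
     "fps_cutoff (Suc n) (qpoch (a + b)) = fps_cutoff (Suc n) qpoch_inf"
    using assms by auto
  have cong: "fps_cutoff (Suc n) (f * g) = fps_cutoff (Suc n) (f' * g')"
    if "fps_cutoff (Suc n) f = fps_cutoff (Suc n) f'" "fps_cutoff (Suc n) g = fps_cutoff (Suc n) g'"
    for f g f' g' :: "rat fps"
  proof -
    have *: "\<And>i. i \<le> n \<Longrightarrow> fps_nth f i = fps_nth f' i" "\<And>i. i \<le> n \<Longrightarrow> fps_nth g i = fps_nth g' i"
      using that by (metis fps_cutoff_nth less_Suc_eq_le)+
    show ?thesis
      by (intro fps_ext) (auto simp: fps_mult_nth * intro!: sum.cong)
  qed
  let ?B = "qbinom (a + b) (int a)"
  have "fps_cutoff (Suc n) ?B = fps_cutoff (Suc n) (?B * (qpoch_inf * qpoch_inf) * (R * R))"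
  proof -
    have "?B * (qpoch_inf * qpoch_inf) * (R * R) = ?B * ((R * qpoch_inf) * (R * qpoch_inf))"
      by (simp only: mult_ac)
    then show ?thesis by (simp only: R mult_1_right)
  qed
  also have "\<dots> = fps_cutoff (Suc n) (?B * (qpoch a * qpoch b) * (R * R))"
    by (intro cong c[symmetric] refl)
  also have "\<dots> = fps_cutoff (Suc n) (qpoch (a + b) * (R * R))"
    by (simp only: qbinom_qpoch)
  also have "\<dots> = fps_cutoff (Suc n) (qpoch_inf * (R * R))"
    by (intro cong c refl)
  also have "qpoch_inf * (R * R) = R" using R by (metis mult.assoc mult.commute mult_1_right)
  finally show ?thesis unfolding R_def by (metis fps_cutoff_nth lessI)
qed

section \<open>Partitions from Frobenius symbols\<close>

text \<open>Wraps the hook with arm \<open>x\<close> and leg \<open>y\<close> around the partition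
  of the remaining columns: \<open>map Suc\<close> and the padding ones together form the
  leg.\<close>

fun unfrob :: "nat list \<Rightarrow> nat list \<Rightarrow> nat list" where
  "unfrob (x # xs) (y # ys) =
     Suc x # map Suc (unfrob xs ys) @ replicate (y - length (unfrob xs ys)) 1"
| "unfrob _ _ = []"

lemma length_unfrob:
  "\<lbrakk>length xs = length ys; sorted_wrt (>) ys\<rbrakk> \<Longrightarrow>
     length (unfrob xs ys) = (case ys of [] \<Rightarrow> 0 | y # _ \<Rightarrow> Suc y)"
  by (induction xs ys rule: unfrob.induct) (auto split: list.splits)

lemma unfrob_le: "\<lbrakk>length xs = length ys; sorted_wrt (>) xs; p \<in> set (unfrob xs ys)\<rbrakk>
   \<Longrightarrow> p \<le> Suc (hd xs)"
proof (induction xs ys arbitrary: p rule: unfrob.induct)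
  case (1 x xs y ys)
  show ?case
  proof (cases "xs = []")
    case True
    then show ?thesis using 1 by auto
  next
    case False
    then have "hd xs < x" using 1 by auto
    then show ?thesis using 1 by fastforce
  qed
qed auto

text \<open>Each hook adds \<open>x + 1 + y\<close> cells. Strict decrease of both rows makes the
  hook long enough to enclose the inner partition.\<close>

lemma is_partition_unfrob:
  "\<lbrakk>length xs = length ys; sorted_wrt (>) xs; sorted_wrt (>) ys\<rbrakk> \<Longrightarrow>
     is_partition (unfrob xs ys) (sum_list (map Suc xs) + sum_list ys)"
proof (induction xs ys rule: unfrob.induct)
  case (1 x xs y ys)
  let ?m = "unfrob xs ys"
  have IH: "is_partition ?m (sum_list (map Suc xs) + sum_list ys)" using 1 by auto
  have "length ?m \<le> y" using 1 length_unfrob[of xs ys] by (auto split: list.splits)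
  moreover have "p \<le> x" if "p \<in> set ?m" for p
  proof -
    have "xs \<noteq> []" using that by auto
    then have "hd xs < x" using 1 by auto
    then show ?thesis using unfrob_le[of xs ys p] that 1 by auto
  qed
  moreover have "sum_list (map Suc l) = sum_list l + length l" for l by (induction l) auto
  moreover have "sorted_wrt (\<ge>) (replicate j (Suc 0))" for j by (induction j) auto
  ultimately show ?case using IH
    by (auto simp: is_partition_def sorted_wrt_append sorted_wrt_map sum_list_replicate)
qed (auto simp: is_partition_def)

text \<open>The number of parts determines \<open>y\<close>, the first part determines
  \<open>x\<close>, and the rest is recovered by stripping the hook.\<close>

lemma unfrob_inject:
  "\<lbrakk>length xs = length ys; sorted_wrt (>) xs; sorted_wrt (>) ys;
    length xs' = length ys'; sorted_wrt (>) xs'; sorted_wrt (>) ys';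
    unfrob xs ys = unfrob xs' ys'\<rbrakk> \<Longrightarrow> xs = xs' \<and> ys = ys'"
proof (induction xs ys arbitrary: xs' ys' rule: unfrob.induct)
  case (1 x xs y ys)
  then obtain x' xs2 y' ys2 where e: "xs' = x' # xs2" "ys' = y' # ys2"
    by (cases xs'; cases ys') auto
  \<comment> \<open>Inner parts become at least 2, which separates them from the padding
    ones.\<close>
  have pos: "filter (\<lambda>p. p > 1) (map Suc (unfrob xs ys) @ replicate j 1) = map Suc (unfrob xs ys)"
    if "length xs = length ys" "sorted_wrt (>) xs" "sorted_wrt (>) ys" for j xs ys
    using is_partition_unfrob[OF that] by (auto simp: is_partition_def filter_id_conv)
  have "length (unfrob (x # xs) (y # ys)) = Suc y"
    using "1.prems"(1,3) by (simp only: length_unfrob list.case)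
  moreover have "length (unfrob xs' ys') = Suc y'"
    using "1.prems"(4,6) e by (simp only: length_unfrob list.case)
  ultimately have "y = y'" using "1.prems"(7) by (metis Suc_inject)
  moreover have "map Suc (unfrob xs ys) = map Suc (unfrob xs2 ys2)"
    using 1 e pos[of xs ys "y - length (unfrob xs ys)"] pos[of xs2 ys2 "y' - length (unfrob xs2 ys2)"]
    by auto
  then have "unfrob xs ys = unfrob xs2 ys2" by (simp add: inj_map_eq_map)
  ultimately show ?case using 1 e by auto
next
  case ("2_1" v) then show ?case by (cases xs'; cases ys') auto
next
  case ("2_2" v) then show ?case by (cases xs'; cases ys') auto
qed

text \<open>Induction on the number of parts: strip the first hook, leaving
  \<open>mu\<close>.\<close>

lemma unfrob_surj:
  "is_partition lam n \<Longrightarrow> \<exists>xs ys. length xs = length ys \<and> sorted_wrt (>) xs \<and>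
     sorted_wrt (>) ys \<and> unfrob xs ys = lam"
proof (induction "length lam" arbitrary: lam n rule: less_induct)
  case less
  show ?case
  proof (cases lam)
    case Nil
    then show ?thesis by (intro exI[of _ "[]"]) auto
  next
    case (Cons p ps)
    define mu where "mu = map (\<lambda>p. p - 1) (filter (\<lambda>p. p > 1) ps)"
    have part: "sorted_wrt (\<ge>) ps" "\<forall>q\<in>set ps. 0 < q \<and> q \<le> p" "0 < p"
      using less.prems Cons by (auto simp: is_partition_def)
    \<comment> \<open>The parts missing from \<open>mu\<close> are ones, and these stand at the end
      of the decreasing \<open>ps\<close>.\<close>
    have split: "ps = map Suc mu @ replicate (length ps - length mu) 1"
      using part(1,2) unfolding mu_def
    proof (induction ps)
      case (Cons q ps)
      show ?case
      proof (cases "q > 1")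
        case True
        then show ?thesis using Cons by simp
      next
        case False
        then have "q = 1" "filter (\<lambda>p. p > 1) ps = []" using Cons.prems by (auto simp: filter_empty_conv)
        then show ?thesis using Cons by simp
      qed
    qed simp
    have len: "length mu \<le> length ps" by (simp add: mu_def)
    have "is_partition mu (sum_list mu)"
    proof -
      have "sorted_wrt (\<lambda>x y. y - 1 \<le> x - 1) (filter (\<lambda>p. p > 1) ps)"
        by (rule sorted_wrt_mono_rel[OF _ sorted_wrt_filter[OF part(1)]]) auto
      then show ?thesis by (auto simp: is_partition_def mu_def sorted_wrt_map)
    qed
    moreover have "length mu < length lam" using len Cons by simp
    ultimately obtain xs ys where xy: "length xs = length ys" "sorted_wrt (>) xs"
       "sorted_wrt (>) ys" "unfrob xs ys = mu"
      using less.hyps by blast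
    have "sorted_wrt (>) ((p - 1) # xs)"
    proof (cases xs)
      case (Cons x xs')
      moreover then obtain y ys' where "ys = y # ys'" using xy by (cases ys) auto
      ultimately have "Suc x \<in> set mu" using xy by auto
      \<comment> \<open>The part \<open>x + 1\<close> of \<open>mu\<close> comes from a part
        \<open>x + 2\<close> of \<open>ps\<close>, which is at most \<open>p\<close>.\<close>
      then have "x < p - 1" using part(2) by (auto simp: mu_def)
      then show ?thesis using xy Cons by auto
    qed auto
    moreover have "sorted_wrt (>) (length ps # ys)"
      using len xy length_unfrob[of xs ys] by (cases ys) auto
    moreover have "unfrob ((p - 1) # xs) (length ps # ys) = lam"
      using split xy Cons part by simp
    ultimately show ?thesis using xy by (metis length_Cons)
  qed
qed

section \<open>Diagonal, arms and legs of the partition built from a symbol\<close>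

lemma strict_sorted_ge: "sorted_wrt (>) (x # xs) \<Longrightarrow> length xs \<le> (x :: nat)"
proof (induction xs arbitrary: x)
  case (Cons y ys)
  then have "length ys \<le> y" by simp
  then show ?case using Cons.prems by simp
qed simp

lemma unfrob_nth:
  "\<lbrakk>length xs = length ys; i < length xs\<rbrakk> \<Longrightarrow>
     i < length (unfrob xs ys) \<and> unfrob xs ys ! i = xs ! i + Suc i"
proof (induction xs ys arbitrary: i rule: unfrob.induct)
  case (1 x xs y ys)
  then show ?case using 1(1)[of "i - 1"] by (cases i) (auto simp: nth_append intro: trans_less_add1)
qed auto

lemma conj_part_unfrob:
  "\<lbrakk>length xs = length ys; sorted_wrt (>) xs; sorted_wrt (>) ys; i < length xs\<rbrakk> \<Longrightarrow>
     conj_part (unfrob xs ys) (Suc i) = ys ! i + Suc i"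
proof (induction xs ys arbitrary: i rule: unfrob.induct)
  case (1 x xs y ys)
  show ?case
  proof (cases i)
    case 0
    have "\<forall>p\<in>set (unfrob (x # xs) (y # ys)). Suc 0 \<le> p"
      using is_partition_unfrob[OF "1.prems"(1-3)] by (auto simp: is_partition_def Suc_le_eq)
    then have "conj_part (unfrob (x # xs) (y # ys)) (Suc 0) = length (unfrob (x # xs) (y # ys))"
      unfolding conj_part_def by (simp only: filter_True)
    then show ?thesis using 0 length_unfrob[OF "1.prems"(1,3)] by simp
  next
    case (Suc j)
    \<comment> \<open>Hence the first row reaches column \<open>Suc i\<close> and adds one cell to
      the column of the inner partition.\<close>
    have "j < x" using strict_sorted_ge[OF "1.prems"(2)] "1.prems"(1,4) Suc by simp
    have "conj_part (unfrob (x # xs) (y # ys)) (Suc i) = Suc (conj_part (unfrob xs ys) (Suc j))"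
      using \<open>j < x\<close> Suc by (simp add: conj_part_def filter_map o_def)
    then show ?thesis using 1 Suc by simp
  qed
qed auto

text \<open>The diagonal consists of the corner cell and the shifted diagonal of the inner
  partition; padding ones do not reach it.\<close>

lemma frob_d_unfrob:
  "length xs = length ys \<Longrightarrow> frob_d (unfrob xs ys) = length xs"
proof (induction xs ys rule: unfrob.induct)
  case (1 x xs y ys)
  let ?S = "\<lambda>lam. {i \<in> {1..length lam}. i \<le> lam ! (i - 1)}"
  let ?m = "unfrob xs ys"
  have "?S (unfrob (x # xs) (y # ys)) = insert 1 (Suc ` ?S ?m)"
  proof (intro set_eqI)
    fix i
    show "i \<in> ?S (unfrob (x # xs) (y # ys)) \<longleftrightarrow> i \<in> insert 1 (Suc ` ?S ?m)"
    proof (cases "\<exists>j. i = Suc (Suc j)")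
      case True
      then obtain j where j: "i = Suc (Suc j)" by blast
      show ?thesis unfolding j by (auto simp: nth_append image_iff)
    next
      case False
      then have "i = 0 \<or> i = 1" by presburger
      then show ?thesis by auto
    qed
  qed
  then have "frob_d (unfrob (x # xs) (y # ys)) = card (insert 1 (Suc ` ?S ?m))"
    unfolding frob_d_def by (rule arg_cong)
  also have "\<dots> = Suc (card (?S ?m))"
    by (subst card_insert_disjoint) (auto simp: card_image)
  finally show ?case using 1 by (simp add: frob_d_def)
qed (auto simp: frob_d_def)

lemma col_signs_unfrob:
  assumes "length xs = length ys" "sorted_wrt (>) xs" "sorted_wrt (>) ys"
  shows "col_signs (unfrob xs ys) = map2 (\<lambda>x y. y < x) xs ys"
proof (rule nth_equalityI)
  fix i assume "i < length (col_signs (unfrob xs ys))"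
  then have i: "i < length xs" using assms by (simp add: col_signs_def frob_d_unfrob del: upt_Suc)
  have "(1 \<le> int a - int b) = (b < a)" for a b by auto
  with i show "col_signs (unfrob xs ys) ! i = map2 (\<lambda>x y. y < x) xs ys ! i"
    using assms unfrob_nth[of xs ys i] conj_part_unfrob[of xs ys i]
    by (simp add: col_signs_def frob_d_unfrob col_positive_def frob_x_def frob_y_def del: upt_Suc)
qed (use assms in \<open>simp add: col_signs_def frob_d_unfrob del: upt_Suc\<close>)

section \<open>Generating functions of half-read Frobenius symbols\<close>

text \<open>The columns of the unread part of a Frobenius symbol: the surplus entries of the longer row
  belong to columns of which one entry, and hence the sign, is already read. So the rows are aligned
  at their ends.\<close>
definition align_signs :: "nat list \<Rightarrow> nat list \<Rightarrow> bool list" where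
  "align_signs xs ys = map2 (\<lambda>x y. y < x) (drop (length xs - length ys) xs) (drop (length ys - length xs) ys)"

text \<open>If \<open>ys\<close> has surplus entries, \<open>v\<close> faces the last of them, which
  is smaller; otherwise \<open>v\<close> is itself surplus.\<close>

lemma align_signs_Cons_left:
  assumes "\<forall>y\<in>set ys. y < v"
  shows "align_signs (v # xs) ys =
    (if length xs < length ys then True # align_signs xs ys else align_signs xs ys)"
proof (cases "length xs < length ys")
  case True
  then have "drop (length ys - Suc (length xs)) ys =
      ys ! (length ys - Suc (length xs)) # drop (length ys - length xs) ys"
    by (metis Cons_nth_drop_Suc Suc_diff_Suc diff_less length_greater_0_conv list.size(3) not_less0 zero_less_Suc)
  then show ?thesis using assms True by (simp add: align_signs_def)
next
  case False
  then show ?thesis by (simp add: align_signs_def Suc_diff_le)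
qed

text \<open>The bound allows equality because at equal values the \<open>y\<close> is read first;
  such a column is negative.\<close>

lemma align_signs_Cons_right:
  assumes "\<forall>x\<in>set xs. x \<le> v"
  shows "align_signs xs (v # ys) =
    (if length ys < length xs then False # align_signs xs ys else align_signs xs ys)"
proof (cases "length ys < length xs")
  case True
  then have "drop (length xs - Suc (length ys)) xs =
      xs ! (length xs - Suc (length ys)) # drop (length xs - length ys) xs"
    by (metis Cons_nth_drop_Suc Suc_diff_Suc diff_less length_greater_0_conv list.size(3) not_less0 zero_less_Suc)
  then show ?thesis using assms True by (simp add: align_signs_def leD)
next
  case False
  then show ?thesis by (simp add: align_signs_def Suc_diff_le)
qed

text \<open>\<open>N\<close> counts the unread positions \<open>\<dots>, y = 1, x = 1, y = 0, x = 0\<close> and \<open>D\<close> is the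
  height of the walk, which has to return to \<open>0\<close>.\<close>
definition frob_pairs :: "nat \<Rightarrow> int \<Rightarrow> (nat list \<times> nat list) set" where
  "frob_pairs N D = {(xs, ys). sorted_wrt (>) xs \<and> sorted_wrt (>) ys \<and>
     (\<forall>x\<in>set xs. x < (N + 1) div 2) \<and> (\<forall>y\<in>set ys. y < N div 2) \<and>
     int (length ys) - int (length xs) = D}"

definition weight :: "nat list \<times> nat list \<Rightarrow> nat" where
  "weight p = sum_list (map Suc (fst p)) + sum_list (snd p)"

definition frob_gf :: "(bool list \<Rightarrow> bool) \<Rightarrow> nat \<Rightarrow> int \<Rightarrow> rat fps" where
  "frob_gf Q N D =
     (\<Sum>p\<in>{p \<in> frob_pairs N D. Q (align_signs (fst p) (snd p))}. fps_X ^ weight p)"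

lemma finite_frob_pairs [simp]: "finite (frob_pairs N D)"
proof -
  have distinct: "sorted_wrt (>) xs \<Longrightarrow> distinct xs" for xs :: "nat list"
    by (induction xs) auto
  have "finite {xs :: nat list. sorted_wrt (>) xs \<and> (\<forall>x\<in>set xs. x < M)}" for M
  proof (rule finite_subset)
    show "{xs :: nat list. sorted_wrt (>) xs \<and> (\<forall>x\<in>set xs. x < M)} \<subseteq>
       {xs. set xs \<subseteq> {..<M} \<and> distinct xs}"
      using distinct by auto
    show "finite {xs. set xs \<subseteq> {..<M} \<and> distinct xs}"
      by (rule finite_subset_distinct) simp
  qed
  note f = this
  show ?thesis
    by (rule finite_subset[OF _ finite_cartesian_product[OF f[of "(N + 1) div 2"] f[of "N div 2"]]])
      (auto simp: frob_pairs_def)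
qed

lemma sorted_wrt_gt_bounded_split:
  "{xs. sorted_wrt (>) xs \<and> (\<forall>x\<in>set xs. x < Suc v)} =
     {xs. sorted_wrt (>) xs \<and> (\<forall>x\<in>set xs. x < v)} \<union>
     (#) v ` {xs. sorted_wrt (>) xs \<and> (\<forall>x\<in>set xs. x < v)}" (is "?A (Suc v) = _")
proof (intro set_eqI iffI)
  fix xs assume xs: "xs \<in> ?A (Suc v)"
  show "xs \<in> ?A v \<union> (#) v ` ?A v"
  proof (cases xs)
    case (Cons x zs)
    then have "x < v \<or> x = v" "\<forall>z\<in>set zs. z < x" using xs by auto
    then show ?thesis using xs Cons by fastforce
  qed simp
qed (auto simp: less_Suc_eq)

lemma frob_pairs_odd:
  "frob_pairs (Suc (2 * v)) D =
     frob_pairs (2 * v) D \<union> (\<lambda>(xs, ys). (v # xs, ys)) ` frob_pairs (2 * v) (D + 1)"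
proof -
  let ?S = "\<lambda>v. {xs. sorted_wrt (>) xs \<and> (\<forall>x\<in>set xs. x < v)}"
  have "(xs, ys) \<in> frob_pairs (Suc (2 * v)) D \<longleftrightarrow>
     xs \<in> ?S (Suc v) \<and> ys \<in> ?S v \<and> int (length ys) - int (length xs) = D" for xs ys
    by (auto simp: frob_pairs_def)
  also have "\<dots> xs ys \<longleftrightarrow> (xs, ys) \<in>  frob_pairs (2 * v) D \<union> (\<lambda>(xs, ys). (v # xs, ys)) ` frob_pairs (2 * v) (D + 1)"
    for xs ys unfolding sorted_wrt_gt_bounded_split
    by (auto simp: frob_pairs_def image_iff)
  finally show ?thesis by auto
qed

lemma frob_pairs_even:
  "frob_pairs (Suc (Suc (2 * v))) D =
     frob_pairs (Suc (2 * v)) D \<union> (\<lambda>(xs, ys). (xs, v # ys)) ` frob_pairs (Suc (2 * v)) (D - 1)"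
proof -
  let ?S = "\<lambda>v. {xs. sorted_wrt (>) xs \<and> (\<forall>x\<in>set xs. x < v)}"
  have "(xs, ys) \<in> frob_pairs (Suc (Suc (2 * v))) D \<longleftrightarrow>
     (sorted_wrt (>) xs \<and> (\<forall>x\<in>set xs. x < Suc v)) \<and> ys \<in> ?S (Suc v) \<and> int (length ys) - int (length xs) = D" for xs ys
    by (auto simp: frob_pairs_def)
  also have "\<dots> xs ys \<longleftrightarrow> (xs, ys) \<in> frob_pairs (Suc (2 * v)) D \<union> (\<lambda>(xs, ys). (xs, v # ys)) ` frob_pairs (Suc (2 * v)) (D - 1)"
    for xs ys unfolding sorted_wrt_gt_bounded_split[of v]
    by (auto simp: frob_pairs_def image_iff)
  finally show ?thesis by auto
qed

text \<open>The next position is \<open>x = v\<close>: it is skipped, or read with weight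
  \<open>v + 1\<close> (the diagonal cell is charged to \<open>x\<close>) and an up step. From
  \<open>D \<ge> 0\<close> this step opens a column whose \<open>y\<close> comes later, hence a
  positive one; from \<open>D < 0\<close> it completes a column whose sign is already known.\<close>

lemma frob_gf_odd:
  "frob_gf Q (Suc (2 * v)) D = frob_gf Q (2 * v) D +
     fps_X ^ Suc v * frob_gf (\<lambda>L. Q (if D \<ge> 0 then True # L else L)) (2 * v) (D + 1)"
proof -
  let ?h = "\<lambda>(xs, ys). (v # xs, ys :: nat list)"
  let ?A = "{p \<in> frob_pairs (2 * v) D. Q (align_signs (fst p) (snd p))}"
  let ?B = "{p \<in> frob_pairs (2 * v) (D + 1). Q (if D \<ge> 0 then True # align_signs (fst p) (snd p) else align_signs (fst p) (snd p))}"
  have sg: "align_signs (v # xs) ys = (if D \<ge> 0 then True # align_signs xs ys else align_signs xs ys)"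
    if "(xs, ys) \<in> frob_pairs (2 * v) (D + 1)" for xs ys
    using that by (subst align_signs_Cons_left) (auto simp: frob_pairs_def)
  have eq: "{p \<in> frob_pairs (Suc (2 * v)) D. Q (align_signs (fst p) (snd p))} = ?A \<union> ?h ` ?B"
    unfolding frob_pairs_odd by (auto simp: sg image_iff split: prod.splits)
  have "(v # xs, ys) \<notin> frob_pairs (2 * v) D" for xs ys
    by (simp add: frob_pairs_def)
  then have disj: "?A \<inter> ?h ` ?B = {}" by fastforce
  have inj: "inj_on ?h ?B" by (rule inj_onI) (auto split: prod.splits)
  have "frob_gf Q (Suc (2 * v)) D = (\<Sum>p\<in>?A \<union> ?h ` ?B. fps_X ^ weight p)"
    by (simp only: frob_gf_def eq)
  also have "\<dots> = (\<Sum>p\<in>?A. fps_X ^ weight p) + (\<Sum>p\<in>?h ` ?B. fps_X ^ weight p)"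
    by (rule sum.union_disjoint) (use disj in auto)
  also have "(\<Sum>p\<in>?h ` ?B. fps_X ^ weight p) = (\<Sum>p\<in>?B. fps_X ^ weight (?h p) :: rat fps)"
    by (simp only: sum.reindex[OF inj] o_def)
  also have "(\<Sum>p\<in>?B. fps_X ^ weight (?h p)) = (\<Sum>p\<in>?B. fps_X ^ Suc v * fps_X ^ weight p :: rat fps)"
    by (intro sum.cong refl) (auto simp: weight_def power_add mult_ac)
  also have "\<dots> = fps_X ^ Suc v * (\<Sum>p\<in>?B. fps_X ^ weight p)"
    by (simp only: sum_distrib_left)
  finally show ?thesis by (simp only: frob_gf_def)
qed

text \<open>Dually, the next position is \<open>y = v\<close>, and a down step from
  \<open>D \<le> 0\<close> opens a negative column.\<close>

lemma frob_gf_even: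
  "frob_gf Q (Suc (Suc (2 * v))) D = frob_gf Q (Suc (2 * v)) D +
     fps_X ^ v * frob_gf (\<lambda>L. Q (if D \<le> 0 then False # L else L)) (Suc (2 * v)) (D - 1)"
proof -
  let ?h = "\<lambda>(xs, ys). (xs :: nat list, v # ys)"
  let ?A = "{p \<in> frob_pairs (Suc (2 * v)) D. Q (align_signs (fst p) (snd p))}"
  let ?B = "{p \<in> frob_pairs (Suc (2 * v)) (D - 1). Q (if D \<le> 0 then False # align_signs (fst p) (snd p) else align_signs (fst p) (snd p))}"
  have sg: "align_signs xs (v # ys) = (if D \<le> 0 then False # align_signs xs ys else align_signs xs ys)"
    if "(xs, ys) \<in> frob_pairs (Suc (2 * v)) (D - 1)" for xs ys
    using that by (subst align_signs_Cons_right) (auto simp: frob_pairs_def)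
  have eq: "{p \<in> frob_pairs (Suc (Suc (2 * v))) D. Q (align_signs (fst p) (snd p))} = ?A \<union> ?h ` ?B"
    unfolding frob_pairs_even by (auto simp: sg image_iff split: prod.splits)
  have "(xs, v # ys) \<notin> frob_pairs (Suc (2 * v)) D" for xs ys
    by (simp add: frob_pairs_def)
  then have disj: "?A \<inter> ?h ` ?B = {}" by fastforce
  have inj: "inj_on ?h ?B" by (rule inj_onI) (auto split: prod.splits)
  have "frob_gf Q (Suc (Suc (2 * v))) D = (\<Sum>p\<in>?A \<union> ?h ` ?B. fps_X ^ weight p)"
    by (simp only: frob_gf_def eq)
  also have "\<dots> = (\<Sum>p\<in>?A. fps_X ^ weight p) + (\<Sum>p\<in>?h ` ?B. fps_X ^ weight p)"
    by (rule sum.union_disjoint) (use disj in auto)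
  also have "(\<Sum>p\<in>?h ` ?B. fps_X ^ weight p) = (\<Sum>p\<in>?B. fps_X ^ weight (?h p) :: rat fps)"
    by (simp only: sum.reindex[OF inj] o_def)
  also have "(\<Sum>p\<in>?B. fps_X ^ weight (?h p)) = (\<Sum>p\<in>?B. fps_X ^ v * fps_X ^ weight p :: rat fps)"
    by (intro sum.cong refl) (auto simp: weight_def power_add mult_ac)
  also have "\<dots> = fps_X ^ v * (\<Sum>p\<in>?B. fps_X ^ weight p)"
    by (simp only: sum_distrib_left)
  finally show ?thesis by (simp only: frob_gf_def)
qed

lemma frob_gf_0:
  "frob_gf Q 0 D = (if D = 0 \<and> Q [] then 1 else 0)"
proof -
  have "frob_pairs 0 D = (if D = 0 then {([], [])} else {})"
    by (auto simp: frob_pairs_def)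
  then have "{p \<in> frob_pairs 0 D. Q (align_signs (fst p) (snd p))} = (if D = 0 \<and> Q [] then {([], [])} else {})"
    by (auto simp: align_signs_def)
  then show ?thesis by (simp add: frob_gf_def weight_def)
qed

section \<open>The reflection principle\<close>

definition tri :: "int \<Rightarrow> nat" where
  "tri d = nat (d * (d + 1) div 2)"

text \<open>A product of consecutive integers is even and nonnegative, so \<open>div\<close> and
  \<open>nat\<close> lose nothing, even for negative \<open>d\<close>.\<close>

lemma int_tri: "2 * int (tri d) = d * (d + 1)"
proof -
  have "0 \<le> d * (d + 1)" by (cases "d \<ge> 0") (auto simp: mult_nonpos_nonpos)
  moreover have "even (d * (d + 1))" by simp
  ultimately show ?thesis by (simp add: tri_def)
qed

text \<open>All walks whose remaining steps sum up to \<open>d\<close>; see \<open>frob_gf_True\<close>.\<close>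
definition path_gf :: "nat \<Rightarrow> int \<Rightarrow> rat fps" where
  "path_gf N d = fps_X ^ tri d * qbinom N (int (N div 2) + d)"

lemma path_gf_0: "path_gf 0 d = (if d = 0 then 1 else 0)"
  by (cases "d < 0"; cases "d > 0") (auto simp: path_gf_def tri_def)

text \<open>The Pascal rule, its exponent converted by \<open>tri d - tri (d - 1) = d\<close>.
  Beyond the case bound all binomials vanish.\<close>

lemma path_gf_odd:
  "path_gf (Suc (2 * v)) d = path_gf (2 * v) d + fps_X ^ Suc v * path_gf (2 * v) (d - 1)"
proof (cases "d \<le> int v + 1")
  case True
  have "2 * int (tri d + nat (int v + 1 - d)) = 2 * int (Suc v + tri (d - 1))"
    using True by (simp only: of_nat_add distrib_left int_tri) (simp add: algebra_simps)
  then have "tri d + nat (int v + 1 - d) = Suc v + tri (d - 1)" by (metis of_nat_eq_iff mult_cancel_left zero_neq_numeral)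
  then have e: "fps_X ^ tri d * fps_X ^ nat (int v + 1 - d) =
      (fps_X ^ Suc v * fps_X ^ tri (d - 1) :: rat fps)" by (metis power_add)
  have q: "qbinom (Suc (2 * v)) (int v + d) = qbinom (2 * v) (int v + d) +
       fps_X ^ nat (int v + 1 - d) * qbinom (2 * v) (int v + d - 1)"
    using qbinom_pascal'[of "int v + d" "2 * v"] True by (simp add: algebra_simps)
  show ?thesis
    unfolding path_gf_def using q e
    by (simp add: distrib_left mult.assoc[symmetric] add_diff_eq del: power_Suc)
qed (simp add: path_gf_def)

lemma path_gf_even:
  "path_gf (Suc (Suc (2 * v))) d =
     path_gf (Suc (2 * v)) d + fps_X ^ v * path_gf (Suc (2 * v)) (d + 1)"
proof (cases "0 \<le> int v + 1 + d")
  case True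
  have "2 * int (tri d + nat (int v + 1 + d)) = 2 * int (v + tri (d + 1))"
    using True by (simp only: of_nat_add distrib_left int_tri) (simp add: algebra_simps)
  then have "tri d + nat (int v + 1 + d) = v + tri (d + 1)" by (metis of_nat_eq_iff mult_cancel_left zero_neq_numeral)
  then have e: "fps_X ^ tri d * fps_X ^ nat (int v + 1 + d) =
      (fps_X ^ v * fps_X ^ tri (d + 1) :: rat fps)" by (metis power_add)
  have q: "qbinom (Suc (Suc (2 * v))) (int v + 1 + d) = qbinom (Suc (2 * v)) (int v + d) +
       fps_X ^ nat (int v + 1 + d) * qbinom (Suc (2 * v)) (int v + 1 + d)"
    using qbinom_pascal[of "int v + 1 + d" "Suc (2 * v)"] True by (simp add: algebra_simps)
  show ?thesis
    unfolding path_gf_def using q e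
    by (simp add: distrib_left mult.assoc[symmetric] add_ac)
qed (simp add: path_gf_def)

text \<open>Symmetry of the binomial sends \<open>d\<close> to \<open>- d\<close>, and
  \<open>tri d - tri (- d) = d\<close>. Powers on both sides cover either sign of
  \<open>d\<close>.\<close>

lemma path_gf_even_reflect:
  assumes "int a - int b = d"
  shows "fps_X ^ b * path_gf (2 * v) d = fps_X ^ a * path_gf (2 * v) (- d)"
proof -
  have "2 * int (b + tri d) = 2 * int (a + tri (- d))"
    by (simp only: of_nat_add distrib_left int_tri assms[symmetric]) (simp add: algebra_simps)
  then have "b + tri d = a + tri (- d)" by (metis of_nat_eq_iff mult_cancel_left zero_neq_numeral)
  then show ?thesis
    using qbinom_symmetric[of "2 * v" "int v + d"]
    by (simp add: path_gf_def mult.assoc[symmetric] power_add[symmetric])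
qed

text \<open>For an odd number of positions the centre moves by one half, so \<open>d\<close> goes to
  \<open>1 - d\<close>, and \<open>tri d - tri (1 - d) = 2 * d - 1\<close>.\<close>

lemma path_gf_odd_reflect:
  assumes "int a - int b = 2 * d - 1"
  shows "fps_X ^ b * path_gf (Suc (2 * v)) d = fps_X ^ a * path_gf (Suc (2 * v)) (1 - d)"
proof -
  have "4 * int (b + tri d) = 4 * int (a + tri (1 - d))"
  proof -
    have "2 * (2 * int (tri d)) + 4 * int b = 2 * (2 * int (tri (1 - d))) + 4 * int a"
      unfolding int_tri using assms by (simp add: algebra_simps)
    then show ?thesis by simp
  qed
  then have "b + tri d = a + tri (1 - d)" by (metis of_nat_eq_iff mult_cancel_left zero_neq_numeral)
  then show ?thesis
    using qbinom_symmetric[of "Suc (2 * v)" "int v + d"]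
    by (simp add: path_gf_def mult.assoc[symmetric] power_add[symmetric] algebra_simps)
qed

section \<open>Walks that hit \<open>1\<close> and \<open>-1\<close> alternately\<close>

text \<open>Greedy search for an alternating subsequence of length \<open>k\<close> that begins with
  \<open>s\<close>.\<close>

fun hits :: "bool \<Rightarrow> nat \<Rightarrow> bool list \<Rightarrow> bool" where
  "hits s 0 L = True"
| "hits s (Suc k) [] = False"
| "hits s (Suc k) (b # L) = (if b = s then hits (\<not> s) k L else hits s (Suc k) L)"

lemma step2_induct [case_names zero odd even]:
  assumes "P 0" "\<And>v. P (2 * v) \<Longrightarrow> P (Suc (2 * v))" "\<And>v. P (Suc (2 * v)) \<Longrightarrow> P (Suc (Suc (2 * v)))"
  shows "P (n :: nat)"
proof (induction n)
  case (Suc n)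
  then show ?case
  proof (cases "even n")
    case True then show ?thesis using assms(2) Suc by (auto elim: evenE)
  next
    case False then show ?thesis using assms(3) Suc by (auto elim!: oddE)
  qed
qed (fact assms(1))

text \<open>Both sides obey the same recursion; from height \<open>D\<close> the remaining steps
  must sum to \<open>- D\<close>.\<close>

lemma frob_gf_True: "frob_gf (\<lambda>_. True) N D = path_gf N (- D)"
proof (induction N arbitrary: D rule: step2_induct)
  case (odd v) then show ?case by (simp add: frob_gf_odd path_gf_odd)
next
  case (even v) then show ?case by (simp add: frob_gf_even path_gf_even)
qed (auto simp: frob_gf_0 path_gf_0)

text \<open>The assumption says that both sides agree once the walk hits \<open>1\<close>; similarly for \<open>-1\<close> below.\<close>
lemma frob_gf_hits_True:
  assumes "\<And>v. A * frob_gf (hits False k) (2 * v) 1 = B * path_gf (2 * v) (E - 1)"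
    and "E > 0" "D \<le> 0"
  shows "A * frob_gf (hits True (Suc k)) N D = B * path_gf N (E - D)"
  using assms(3)
proof (induction N arbitrary: D rule: step2_induct)
  case zero
  then show ?case using \<open>E > 0\<close> by (auto simp: frob_gf_0 path_gf_0)
next
  case (odd v)
  have "A * frob_gf (hits True (Suc k)) (Suc (2 * v)) D = A * frob_gf (hits True (Suc k)) (2 * v) D +
      fps_X ^ Suc v * (A * frob_gf (\<lambda>L. hits True (Suc k) (if D \<ge> 0 then True # L else L)) (2 * v) (D + 1))"
    unfolding frob_gf_odd by (simp only: distrib_left mult.left_commute)
  \<comment> \<open>Only for \<open>D = 0\<close> does the up step produce the awaited
    \<open>True\<close>, and there the assumption applies; below \<open>0\<close> the induction
    hypothesis suffices.\<close>
  also have "\<dots> = B * path_gf (2 * v) (E - D) + fps_X ^ Suc v * (B * path_gf (2 * v) (E - D - 1))"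
    using odd.IH[of D] odd.IH[of "D + 1"] odd.prems assms(1)[of v] by (cases "D = 0") (auto simp: diff_diff_eq)
  also have "\<dots> = B * path_gf (Suc (2 * v)) (E - D)"
    unfolding path_gf_odd by (simp only: distrib_left mult.left_commute)
  finally show ?case .
next
  case (even v)
  have "A * frob_gf (hits True (Suc k)) (Suc (Suc (2 * v))) D = A * frob_gf (hits True (Suc k)) (Suc (2 * v)) D +
      fps_X ^ v * (A * frob_gf (\<lambda>L. hits True (Suc k) (if D \<le> 0 then False # L else L)) (Suc (2 * v)) (D - 1))"
    unfolding frob_gf_even by (simp only: distrib_left mult.left_commute)
  \<comment> \<open>The \<open>False\<close> produced by a down step is ignored while
    \<open>True\<close> is awaited.\<close>
  also have "\<dots> = B * path_gf (Suc (2 * v)) (E - D) + fps_X ^ v * (B * path_gf (Suc (2 * v)) (E - D + 1))"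
    using even.IH[of D] even.IH[of "D - 1"] even.prems by (simp add: algebra_simps)
  also have "\<dots> = B * path_gf (Suc (Suc (2 * v))) (E - D)"
    unfolding path_gf_even by (simp only: distrib_left mult.left_commute)
  finally show ?case .
qed

lemma frob_gf_hits_False:
  assumes "\<And>v. A * frob_gf (hits True k) (Suc (2 * v)) (-1) = B * path_gf (Suc (2 * v)) (E + 1)"
    and "E < 0" "D \<ge> 0"
  shows "A * frob_gf (hits False (Suc k)) N D = B * path_gf N (E - D)"
  using assms(3)
proof (induction N arbitrary: D rule: step2_induct)
  case zero
  then show ?case using \<open>E < 0\<close> by (auto simp: frob_gf_0 path_gf_0)
next
  case (even v)
  have "A * frob_gf (hits False (Suc k)) (Suc (Suc (2 * v))) D = A * frob_gf (hits False (Suc k)) (Suc (2 * v)) D +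
      fps_X ^ v * (A * frob_gf (\<lambda>L. hits False (Suc k) (if D \<le> 0 then False # L else L)) (Suc (2 * v)) (D - 1))"
    unfolding frob_gf_even by (simp only: distrib_left mult.left_commute)
  also have "\<dots> = B * path_gf (Suc (2 * v)) (E - D) + fps_X ^ v * (B * path_gf (Suc (2 * v)) (E - D + 1))"
    using even.IH[of D] even.IH[of "D - 1"] even.prems assms(1)[of v] by (cases "D = 0") (auto simp: algebra_simps)
  also have "\<dots> = B * path_gf (Suc (Suc (2 * v))) (E - D)"
    unfolding path_gf_even by (simp only: distrib_left mult.left_commute)
  finally show ?case .
next
  case (odd v)
  have "A * frob_gf (hits False (Suc k)) (Suc (2 * v)) D = A * frob_gf (hits False (Suc k)) (2 * v) D +
      fps_X ^ Suc v * (A * frob_gf (\<lambda>L. hits False (Suc k) (if D \<ge> 0 then True # L else L)) (2 * v) (D + 1))"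
    unfolding frob_gf_odd by (simp only: distrib_left mult.left_commute)
  also have "\<dots> = B * path_gf (2 * v) (E - D) + fps_X ^ Suc v * (B * path_gf (2 * v) (E - D - 1))"
    using odd.IH[of D] odd.IH[of "D + 1"] odd.prems by (simp add: diff_diff_eq)
  also have "\<dots> = B * path_gf (Suc (2 * v)) (E - D)"
    unfolding path_gf_odd by (simp only: distrib_left mult.left_commute)
  finally show ?case .
qed

text \<open>The generalised pentagonal numbers; \<open>e\<close> will be the last sign of the
  alternating sequence of length \<open>k\<close>.\<close>

definition pent :: "nat \<Rightarrow> bool \<Rightarrow> nat" where
  "pent k e = (if e then k * (3 * k + 1) div 2 else k * (3 * k - 1) div 2)"

lemma int_pent: "2 * int (pent k e) = int k * (3 * int k + (if e then 1 else -1))"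
proof (cases k)
  case (Suc j)
  have "even (k * (3 * k + 1))" "even (k * (3 * k - 1))" using Suc by auto
  then have "2 * pent k e = (if e then k * (3 * k + 1) else k * (3 * k - 1))"
    by (simp add: pent_def)
  then have "int (2 * pent k e) = int (if e then k * (3 * k + 1) else k * (3 * k - 1))"
    by (rule arg_cong)
  then show ?thesis using Suc by (auto simp: algebra_simps)
qed (simp add: pent_def)

text \<open>The powers of \<open>X\<close> on the left avoid negative exponents; the accumulated exponent \<open>b - a\<close>
  is \<open>-1\<close> for \<open>hits True 1\<close>.\<close>
lemma frob_gf_hits_reflected:
  fixes k :: nat
  defines "Ep \<equiv> int ((3 * k + 1) div 2)" and "Em \<equiv> - int (3 * k div 2)"
  shows "(\<exists>a b. int b - int a + int (tri Ep) = int (pent k (odd k)) \<and>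
      (\<forall>N D. D \<le> 0 \<longrightarrow> fps_X ^ a * frob_gf (hits True k) N D = fps_X ^ b * path_gf N (Ep - D))) \<and>
    (\<exists>a b. int b - int a + int (tri Em) = int (pent k (even k)) \<and>
      (\<forall>N D. D \<ge> 0 \<longrightarrow> fps_X ^ a * frob_gf (hits False k) N D = fps_X ^ b * path_gf N (Em - D)))"
  unfolding Ep_def Em_def
proof (induction k)
  case 0
  have "hits s 0 = (\<lambda>_. True)" for s by auto
  then show ?case
    by (intro conjI; intro exI[of _ "0 :: nat"]) (auto simp: frob_gf_True tri_def pent_def)
next
  case (Suc k)
  let ?Ep = "int ((3 * k + 1) div 2)" and ?Em = "- int (3 * k div 2)"
  let ?Ep' = "int ((3 * Suc k + 1) div 2)" and ?Em' = "- int (3 * Suc k div 2)"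
  \<comment> \<open>From height \<open>1\<close>, reflection sends the displacement
    \<open>?Em - 1\<close> to \<open>1 - ?Em\<close>; from height \<open>-1\<close> it sends
    \<open>?Ep + 1\<close> to \<open>- ?Ep\<close>. Measured from \<open>0\<close>, these are the
    new targets.\<close>
  have Ep': "?Ep' = 2 - ?Em" and Em': "?Em' = - 1 - ?Ep" by presburger+
  have half: "2 * ?Ep = 3 * int k + (if odd k then 1 else 0)"
     "2 * ?Em = (if odd k then 1 else 0) - 3 * int k" by presburger+
  have "\<exists>a b. int b - int a + int (tri ?Ep') = int (pent (Suc k) (odd (Suc k))) \<and>
      (\<forall>N D. D \<le> 0 \<longrightarrow> fps_X ^ a * frob_gf (hits True (Suc k)) N D = fps_X ^ b * path_gf N (?Ep' - D))"
  proof -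
    obtain a b where ab: "int b - int a + int (tri ?Em) = int (pent k (even k))"
      "\<And>N D. D \<ge> 0 \<Longrightarrow> fps_X ^ a * frob_gf (hits False k) N D = fps_X ^ b * path_gf N (?Em - D)"
      using Suc by blast
    \<comment> \<open>The power of \<open>q\<close> that \<open>path_gf_even_reflect\<close> costs
      at \<open>d = ?Em - 1\<close>.\<close>
    define b0 where "b0 = nat (1 - ?Em)"
    have b0: "int b0 = 1 - ?Em" by (simp add: b0_def)
    have "fps_X ^ (a + b0) * frob_gf (hits False k) (2 * v) 1 = fps_X ^ b * path_gf (2 * v) (?Ep' - 1)" for v
    proof -
      have "fps_X ^ (a + b0) * frob_gf (hits False k) (2 * v) 1 =
          fps_X ^ b0 * (fps_X ^ a * frob_gf (hits False k) (2 * v) 1)"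
        by (simp only: power_add mult_ac)
      also have "\<dots> = fps_X ^ b * (fps_X ^ b0 * path_gf (2 * v) (?Em - 1))"
        by (subst ab(2)) (simp_all only: mult_ac zero_le_one)
      also have "fps_X ^ b0 * path_gf (2 * v) (?Em - 1) = path_gf (2 * v) (?Ep' - 1)"
        using path_gf_even_reflect[of 0 b0 "?Em - 1" v] b0 unfolding Ep' by simp
      finally show ?thesis .
    qed
    then have "\<forall>N D. D \<le> 0 \<longrightarrow> fps_X ^ (a + b0) * frob_gf (hits True (Suc k)) N D = fps_X ^ b * path_gf N (?Ep' - D)"
      using Ep' by (intro allI impI frob_gf_hits_True) auto
    moreover have "int b - int (a + b0) + int (tri ?Ep') = int (pent (Suc k) (odd (Suc k)))"
    proof -
      have t: "2 * int (tri ?Ep') = (2 - ?Em) * (3 - ?Em)"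
        unfolding int_tri Ep' by simp
      have "2 * (int b - int (a + b0) + int (tri ?Ep')) =
          2 * (int b - int a + int (tri ?Em)) - 2 * int (tri ?Em) - 2 * int b0 + 2 * int (tri ?Ep')"
        by simp
      also have "\<dots> = 2 * int (pent k (even k)) - ?Em * (?Em + 1) - 2 * (1 - ?Em) + (2 - ?Em) * (3 - ?Em)"
        by (simp only: ab(1) b0 int_tri[of ?Em] t)
      also have "\<dots> = 2 * int (pent k (even k)) - 2 * (2 * ?Em) + 4"
        by (simp add: algebra_simps)
      also have "\<dots> = 2 * int (pent (Suc k) (odd (Suc k)))"
        unfolding half int_pent by (simp add: algebra_simps)
      finally show ?thesis by simp
    qed
    ultimately show ?thesis by blast
  qed
  moreover have "\<exists>a b. int b - int a + int (tri ?Em') = int (pent (Suc k) (even (Suc k))) \<and>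
      (\<forall>N D. D \<ge> 0 \<longrightarrow> fps_X ^ a * frob_gf (hits False (Suc k)) N D = fps_X ^ b * path_gf N (?Em' - D))"
  proof -
    obtain a b where ab: "int b - int a + int (tri ?Ep) = int (pent k (odd k))"
      "\<And>N D. D \<le> 0 \<Longrightarrow> fps_X ^ a * frob_gf (hits True k) N D = fps_X ^ b * path_gf N (?Ep - D)"
      using Suc by blast
    \<comment> \<open>The power of \<open>q\<close> that \<open>path_gf_odd_reflect\<close> yields
      at \<open>d = ?Ep + 1\<close>.\<close>
    define a0 where "a0 = nat (2 * ?Ep + 1)"
    have a0: "int a0 = 2 * ?Ep + 1" by (simp add: a0_def)
    have "fps_X ^ a * frob_gf (hits True k) (Suc (2 * v)) (- 1) =
        fps_X ^ (b + a0) * path_gf (Suc (2 * v)) (?Em' + 1)" for v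
    proof -
      have "fps_X ^ a * frob_gf (hits True k) (Suc (2 * v)) (- 1) =
          fps_X ^ b * path_gf (Suc (2 * v)) (?Ep + 1)"
        by (subst ab(2)) simp_all
      also have "path_gf (Suc (2 * v)) (?Ep + 1) = fps_X ^ a0 * path_gf (Suc (2 * v)) (?Em' + 1)"
        using path_gf_odd_reflect[of a0 0 "?Ep + 1" v] a0 unfolding Em' by simp
      finally show ?thesis by (simp only: power_add mult.assoc)
    qed
    then have "\<forall>N D. D \<ge> 0 \<longrightarrow> fps_X ^ a * frob_gf (hits False (Suc k)) N D = fps_X ^ (b + a0) * path_gf N (?Em' - D)"
      using frob_gf_hits_False[of "fps_X ^ a" k "fps_X ^ (b + a0)" ?Em'] Em' by simp
    moreover have "int (b + a0) - int a + int (tri ?Em') = int (pent (Suc k) (even (Suc k)))"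
    proof -
      have t: "2 * int (tri ?Em') = (1 + ?Ep) * ?Ep"
        unfolding int_tri Em' by (simp add: algebra_simps)
      have "2 * (int (b + a0) - int a + int (tri ?Em')) =
          2 * (int b - int a + int (tri ?Ep)) - 2 * int (tri ?Ep) + 2 * int a0 + 2 * int (tri ?Em')"
        by simp
      also have "\<dots> = 2 * int (pent k (odd k)) - ?Ep * (?Ep + 1) + 2 * (2 * ?Ep + 1) + (1 + ?Ep) * ?Ep"
        by (simp only: ab(1) a0 int_tri[of ?Ep] t)
      also have "\<dots> = 2 * int (pent k (odd k)) + 2 * (2 * ?Ep) + 2"
        by (simp add: algebra_simps)
      also have "\<dots> = 2 * int (pent (Suc k) (even (Suc k)))"
        unfolding half int_pent by (simp add: algebra_simps)
      finally show ?thesis by simp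
    qed
    ultimately show ?thesis by blast
  qed
  ultimately show ?case by blast
qed

text \<open>The shift \<open>E\<close> is left unspecified since it disappears in the limit of large
  \<open>V\<close>. The sign \<open>odd k = s\<close> is the last one of an alternating sequence of
  length \<open>k\<close> starting with \<open>s\<close>.\<close>

lemma frob_gf_hits_qbinom:
  "\<exists>E. \<forall>V. frob_gf (hits s k) (2 * V) 0 =
     fps_X ^ pent k (odd k = s) * qbinom (2 * V) (int V + E)"
proof -
  obtain a b E where ab: "int b - int a + int (tri E) = int (pent k (odd k = s))"
    "\<And>N. fps_X ^ a * frob_gf (hits s k) N 0 = fps_X ^ b * path_gf N E"
  proof (cases s)
    case True then show ?thesis using frob_gf_hits_reflected[of k] that by fastforce
  next
    case False then show ?thesis using frob_gf_hits_reflected[of k] that by fastforce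
  qed
  have e: "b + tri E = a + pent k (odd k = s)" using ab(1) by linarith
  have "fps_X ^ a * frob_gf (hits s k) (2 * V) 0 =
      fps_X ^ a * (fps_X ^ pent k (odd k = s) * qbinom (2 * V) (int V + E))" for V
    unfolding ab(2) path_gf_def by (simp add: mult.assoc[symmetric] power_add[symmetric] e)
  then show ?thesis by (metis fps_X_neq_zero mult_cancel_left power_not_zero)
qed

section \<open>Counting partitions by their column signs\<close>

definition sign_parts :: "(bool list \<Rightarrow> bool) \<Rightarrow> nat \<Rightarrow> nat list set" where
  "sign_parts Q n = {lam. is_partition lam n \<and> Q (col_signs lam)}"

definition sign_gf :: "(bool list \<Rightarrow> bool) \<Rightarrow> rat fps" where
  "sign_gf Q = Abs_fps (\<lambda>n. of_nat (card (sign_parts Q n)))"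

text \<open>No entry of a symbol of weight \<open>n\<close> exceeds \<open>n\<close>, so the bound
  \<open>V\<close> excludes nothing.\<close>

lemma bij_betw_unfrob:
  assumes "n < V"
  shows "bij_betw (\<lambda>(xs, ys). unfrob xs ys)
    {p \<in> frob_pairs (2 * V) 0. Q (align_signs (fst p) (snd p)) \<and> weight p = n} (sign_parts Q n)"
proof -
  have *: "length xs = length ys" "sorted_wrt (>) xs" "sorted_wrt (>) ys"
    if "(xs, ys) \<in> frob_pairs (2 * V) 0" for xs ys
    using that by (auto simp: frob_pairs_def)
  have sg: "col_signs (unfrob xs ys) = align_signs xs ys"
    if "(xs, ys) \<in> frob_pairs (2 * V) 0" for xs ys
    using col_signs_unfrob[OF *[OF that]] *(1)[OF that] by (simp add: align_signs_def)
  show ?thesis unfolding bij_betw_def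
  proof (intro conjI equalityI subsetI)
    show "inj_on (\<lambda>(xs, ys). unfrob xs ys)
      {p \<in> frob_pairs (2 * V) 0. Q (align_signs (fst p) (snd p)) \<and> weight p = n}"
      using * unfrob_inject by (auto simp: inj_on_def; metis)
    fix lam
    assume "lam \<in> (\<lambda>(xs, ys). unfrob xs ys) `
      {p \<in> frob_pairs (2 * V) 0. Q (align_signs (fst p) (snd p)) \<and> weight p = n}"
    then show "lam \<in> sign_parts Q n"
      using is_partition_unfrob[OF *] sg by (auto simp: sign_parts_def weight_def)
  next
    fix lam assume lam: "lam \<in> sign_parts Q n"
    then have "is_partition lam n" by (simp add: sign_parts_def)
    then obtain xs ys where xy: "length xs = length ys" "sorted_wrt (>) xs" "sorted_wrt (>) ys"
      "unfrob xs ys = lam" using unfrob_surj by blast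
    have w: "weight (xs, ys) = n"
      using is_partition_unfrob[OF xy(1-3)] xy(4) lam
      by (auto simp: sign_parts_def is_partition_def weight_def)
    have "x < V" if "x \<in> set xs" for x
      using member_le_sum_list[of "Suc x" "map Suc xs"] that w assms by (auto simp: weight_def)
    moreover have "y < V" if "y \<in> set ys" for y
      using member_le_sum_list[of y ys] that w assms by (auto simp: weight_def)
    ultimately have "(xs, ys) \<in> frob_pairs (2 * V) 0"
      using xy by (auto simp: frob_pairs_def)
    then show "lam \<in> (\<lambda>(xs, ys). unfrob xs ys) `
      {p \<in> frob_pairs (2 * V) 0. Q (align_signs (fst p) (snd p)) \<and> weight p = n}"
      using w sg xy(4) lam by (force simp: sign_parts_def)
  qed
qed

lemma finite_sign_parts: "finite (sign_parts Q n)"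
  using bij_betw_finite[OF bij_betw_unfrob[of n "Suc n" Q]] by simp

lemma sign_gf_nth: "n < V \<Longrightarrow> fps_nth (sign_gf Q) n = fps_nth (frob_gf Q (2 * V) 0) n"
  using bij_betw_same_card[OF bij_betw_unfrob[of n V Q]]
  by (simp add: sign_gf_def frob_gf_def fps_sum_nth fps_X_power_nth sum.If_cases
      Int_def conj_assoc eq_commute[of n])

lemma sign_gf_hits:
  "sign_gf (hits s k) = fps_X ^ pent k (odd k = s) * inverse qpoch_inf"
proof (rule fps_ext)
  fix n
  obtain E where E: "\<And>V. frob_gf (hits s k) (2 * V) 0 =
     fps_X ^ pent k (odd k = s) * qbinom (2 * V) (int V + E)"
    using frob_gf_hits_qbinom by blast
  \<comment> \<open>Large enough for \<open>V + E\<close> and \<open>V - E\<close> both to exceed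
    \<open>n\<close>.\<close>
  define V where "V = n + nat \<bar>E\<bar> + 1"
  define a b where "a = nat (int V + E)" and "b = nat (int V - E)"
  have "2 * V = a + b" "int V + E = int a" by (auto simp: V_def a_def b_def)
  moreover have "fps_nth (qbinom (a + b) (int a)) i = fps_nth (inverse qpoch_inf) i" if "i \<le> n" for i
    by (rule qbinom_nth_limit) (use that in \<open>auto simp: V_def a_def b_def\<close>)
  ultimately have "fps_nth (fps_X ^ pent k (odd k = s) * qbinom (2 * V) (int V + E)) n =
     fps_nth (fps_X ^ pent k (odd k = s) * inverse qpoch_inf) n"
    by (simp only: fps_X_power_mult_nth)
  then show "fps_nth (sign_gf (hits s k)) n = fps_nth (fps_X ^ pent k (odd k = s) * inverse qpoch_inf) n"
    using sign_gf_nth[of n V "hits s k"] by (simp only: E) (simp add: V_def)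
qed

section \<open>From alternating subsequences to parity blocks\<close>

text \<open>A longest alternating subsequence takes one entry from each block, omitting the first
  block if its sign is not \<open>s\<close>.\<close>

lemma hits_iff_remdups_adj:
  "L \<noteq> [] \<Longrightarrow> hits s k L \<longleftrightarrow>
     k \<le> (if hd L = s then length (remdups_adj L) else length (remdups_adj L) - 1)"
proof (induction L arbitrary: s k)
  case (Cons b L)
  show ?case
  proof (cases k)
    case (Suc j)
    show ?thesis
    proof (cases L)
      case Nil
      then show ?thesis using Suc by (cases j) auto
    next
      case (Cons c L')
      then have IH: "hits s k L \<longleftrightarrow>
         k \<le> (if hd L = s then length (remdups_adj L) else length (remdups_adj L) - 1)" for s k
        using Cons.IH by simp
      have "length (remdups_adj L) \<ge> 1" using Cons by (simp add: Suc_le_eq)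
      moreover have "length (remdups_adj (b # L)) = (if b = c then length (remdups_adj L) else Suc (length (remdups_adj L)))"
        using Cons by simp
      moreover have "hd L = c" using Cons by simp
      ultimately show ?thesis using Suc IH[of "\<not> s" j] IH[of s "Suc j"] by (cases b; cases c; cases s) auto
    qed
  qed simp
qed simp

lemma last_iff_odd_remdups_adj:
  "L \<noteq> [] \<Longrightarrow> last L \<longleftrightarrow> (hd L = odd (length (remdups_adj L)))"
proof (induction L)
  case (Cons b L)
  then show ?case by (cases L) auto
qed simp

definition ends_with :: "bool \<Rightarrow> nat \<Rightarrow> bool list \<Rightarrow> bool" where
  "ends_with e m L \<longleftrightarrow> L \<noteq> [] \<and> length (remdups_adj L) = m \<and> last L = e"

lemma hits_Suc_imp_hits: "hits s (Suc k) L \<Longrightarrow> hits s k L"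
  by (cases "L = []") (auto simp: hits_iff_remdups_adj)

text \<open>An alternating sequence of length \<open>m\<close> that starts with \<open>odd m = e\<close> ends with \<open>e\<close>.\<close>
lemma hits_exact_iff:
  "hits (odd m = e) m L \<and> \<not> hits (odd m = e) (Suc m) L \<longleftrightarrow>
     L = [] \<and> m = 0 \<or> ends_with e m L \<or> ends_with e (Suc m) L"
proof (cases "L = []")
  case True
  then show ?thesis by (cases m) (auto simp: ends_with_def)
next
  case False
  define b where "b = length (remdups_adj L)"
  have "b \<ge> 1" using False by (simp add: b_def Suc_le_eq)
  then have "hits s m L \<and> \<not> hits s (Suc m) L \<longleftrightarrow> b = (if hd L = s then m else Suc m)" for s
    unfolding hits_iff_remdups_adj[OF False] b_def[symmetric] by auto
  moreover have "last L \<longleftrightarrow> hd L = odd b"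
    using last_iff_odd_remdups_adj[OF False] by (simp add: b_def)
  ultimately show ?thesis using False unfolding ends_with_def b_def[symmetric]
    by (cases "hd L"; cases e; cases "odd m") auto
qed

lemma sign_gf_union:
  assumes "\<And>L. Q L \<longleftrightarrow> Q1 L \<or> Q2 L" "\<And>L. \<not> (Q1 L \<and> Q2 L)"
  shows "sign_gf Q = sign_gf Q1 + sign_gf Q2"
proof (rule fps_ext)
  fix n
  have "sign_parts Q n = sign_parts Q1 n \<union> sign_parts Q2 n" "sign_parts Q1 n \<inter> sign_parts Q2 n = {}"
    using assms by (auto simp: sign_parts_def)
  then show "fps_nth (sign_gf Q) n = fps_nth (sign_gf Q1 + sign_gf Q2) n"
    by (simp add: sign_gf_def card_Un_disjoint finite_sign_parts)
qed

lemma col_signs_eq_Nil_iff: "is_partition lam n \<Longrightarrow> col_signs lam = [] \<longleftrightarrow> lam = []"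
proof -
  assume "is_partition lam n"
  then obtain xs ys where "length xs = length ys" "sorted_wrt (>) xs" "sorted_wrt (>) ys"
      "unfrob xs ys = lam" using unfrob_surj by blast
  then show ?thesis using col_signs_unfrob[of xs ys] by (cases xs; cases ys) auto
qed

lemma sign_gf_Nil: "sign_gf (\<lambda>L. L = []) = 1"
proof (rule fps_ext)
  fix n
  have "sign_parts (\<lambda>L. L = []) n = (if n = 0 then {[]} else {})"
  proof -
    have "sign_parts (\<lambda>L. L = []) n = {lam. is_partition lam n \<and> lam = []}"
      using col_signs_eq_Nil_iff by (auto simp: sign_parts_def)
    then show ?thesis by (auto simp: is_partition_def)
  qed
  then show "fps_nth (sign_gf (\<lambda>L. L = [])) n = fps_nth 1 n" by (simp add: sign_gf_def)
qed

lemma sign_gf_False [simp]: "sign_gf (\<lambda>L. False) = 0"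
  by (rule fps_ext) (simp add: sign_gf_def sign_parts_def)

lemma ends_with_0 [simp]: "ends_with e 0 = (\<lambda>L. False)"
  by (auto simp: ends_with_def)

text \<open>Subtracts the count for \<open>Suc m\<close> from that for \<open>m\<close> with the
  same starting sign; the longer sequence ends with \<open>\<not> e\<close>. For
  \<open>m = 0\<close> the difference also contains the empty partition, whence the
  correction.\<close>

lemma sign_gf_ends_with_add:
  "sign_gf (ends_with e m) + sign_gf (ends_with e (Suc m)) =
     (fps_X ^ pent m e - fps_X ^ pent (Suc m) (\<not> e)) * inverse qpoch_inf - (if m = 0 then 1 else 0)"
proof -
  let ?s = "odd m = e"
  have "sign_gf (hits ?s m) = sign_gf (hits ?s (Suc m)) +
      sign_gf (\<lambda>L. L = [] \<and> m = 0 \<or> ends_with e m L \<or> ends_with e (Suc m) L)"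
    unfolding hits_exact_iff[symmetric]
    by (rule sign_gf_union) (auto dest: hits_Suc_imp_hits)
  also have "sign_gf (\<lambda>L. L = [] \<and> m = 0 \<or> ends_with e m L \<or> ends_with e (Suc m) L) =
      sign_gf (\<lambda>L. L = [] \<and> m = 0) + sign_gf (\<lambda>L. ends_with e m L \<or> ends_with e (Suc m) L)"
    by (rule sign_gf_union) (auto simp: ends_with_def)
  also have "sign_gf (\<lambda>L. ends_with e m L \<or> ends_with e (Suc m) L) =
      sign_gf (ends_with e m) + sign_gf (ends_with e (Suc m))"
    by (rule sign_gf_union) (auto simp: ends_with_def)
  also have "sign_gf (\<lambda>L. L = [] \<and> m = 0) = (if m = 0 then 1 else 0)"
    by (simp add: sign_gf_Nil)
  finally have "fps_X ^ pent m e * inverse qpoch_inf = fps_X ^ pent (Suc m) (\<not> e) * inverse qpoch_inf +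
      ((if m = 0 then 1 else 0) + (sign_gf (ends_with e m) + sign_gf (ends_with e (Suc m))))"
    unfolding sign_gf_hits by (cases e; cases "odd m") simp_all
  then show ?thesis by (simp only: left_diff_distrib) simp
qed

text \<open>Alternating summation of the previous identity from \<open>ends_with e 0\<close>, which
  nothing satisfies. The empty partition contributes \<open>(-1) ^ Suc m\<close>.\<close>

lemma sign_gf_ends_with:
  "sign_gf (ends_with e (Suc m)) = (-1) ^ Suc m + (-1) ^ m * inverse qpoch_inf *
     (\<Sum>l<Suc m. (-1) ^ l * (fps_X ^ pent l e - fps_X ^ pent (Suc l) (\<not> e)))"
proof (induction m)
  case 0
  then show ?case using sign_gf_ends_with_add[of e 0] by simp
next
  case (Suc m)
  have "sign_gf (ends_with e (Suc (Suc m))) =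
     (fps_X ^ pent (Suc m) e - fps_X ^ pent (Suc (Suc m)) (\<not> e)) * inverse qpoch_inf
      - sign_gf (ends_with e (Suc m))"
    using sign_gf_ends_with_add[of e "Suc m"] by (simp add: eq_diff_eq add.commute)
  then show ?case unfolding Suc sum.lessThan_Suc[of _ "Suc m"]
    by (cases "even m") (simp_all add: algebra_simps del: sum.lessThan_Suc)
qed

theorem theorem1p2:
  fixes m :: nat
  assumes "1 \<le> m"
  shows "Abs_fps (\<lambda>n. if n = 0 then 0 else of_nat (a_plus m n)) =
           (-1) ^ m + (-1) ^ (m - 1) * inverse qpoch_inf *
             (\<Sum>l<m. (-1) ^ l * fps_X ^ (l * (3 * l + 1) div 2) * (1 - fps_X ^ (2 * l + 1))) \<and>
         Abs_fps (\<lambda>n. if n = 0 then 0 else of_nat (a_minus m n)) =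
           (-1) ^ m + (-1) ^ (m - 1) * inverse qpoch_inf *
             (\<Sum>l<m. (-1) ^ l * fps_X ^ (l * (3 * l - 1) div 2) * (1 - fps_X ^ (4 * l + 2)))"
proof -
  obtain j where m: "m = Suc j" using assms by (cases m) auto
  \<comment> \<open>The only partition of \<open>0\<close> has no blocks, so the coefficient at
    \<open>n = 0\<close> vanishes, as in a sum starting at \<open>n = 1\<close>.\<close>
  have "lam = []" if "is_partition lam 0" for lam
    using that by (cases lam) (auto simp: is_partition_def)
  then have "sign_parts (ends_with e m) 0 = {}" for e
    using col_signs_eq_Nil_iff by (auto simp: sign_parts_def ends_with_def)
  then have gf: "sign_gf (ends_with e m) =
      Abs_fps (\<lambda>n. if n = 0 then 0 else of_nat (card (sign_parts (ends_with e m) n)))" for e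
    by (auto simp: sign_gf_def fps_eq_iff)
  have a: "card (sign_parts (ends_with True m) n) = a_plus m n"
    "card (sign_parts (ends_with False m) n) = a_minus m n" for n
    unfolding a_plus_def a_minus_def sign_parts_def ends_with_def num_blocks_def
      last_block_positive_def last_block_negative_def
    by (auto intro!: arg_cong[where f = card])
  \<comment> \<open>Gaps between pentagonal numbers give the factors \<open>1 - q^(2l+1)\<close> and
    \<open>1 - q^(4l+2)\<close>.\<close>
  have p: "pent (Suc l) False = pent l True + (2 * l + 1)" "pent (Suc l) True = pent l False + (4 * l + 2)" for l
  proof -
    have "2 * int (pent (Suc l) False) = 2 * int (pent l True + (2 * l + 1))"
      "2 * int (pent (Suc l) True) = 2 * int (pent l False + (4 * l + 2))"
      by (simp_all only: of_nat_add distrib_left int_pent) (simp_all add: algebra_simps)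
    then show "pent (Suc l) False = pent l True + (2 * l + 1)"
      "pent (Suc l) True = pent l False + (4 * l + 2)"
      by (simp_all only: mult_cancel_left of_nat_eq_iff) simp_all
  qed
  have t: "(-1) ^ l * (fps_X ^ pent l True - fps_X ^ pent (Suc l) (\<not> True)) =
      (-1) ^ l * fps_X ^ (l * (3 * l + 1) div 2) * (1 - fps_X ^ (2 * l + 1) :: rat fps)"
    "(-1) ^ l * (fps_X ^ pent l False - fps_X ^ pent (Suc l) (\<not> False)) =
      (-1) ^ l * fps_X ^ (l * (3 * l - 1) div 2) * (1 - fps_X ^ (4 * l + 2) :: rat fps)" for l
    unfolding not_True_eq_False not_False_eq_True p power_add
    by (simp_all add: pent_def algebra_simps)
  show ?thesis
    using sign_gf_ends_with[of True j] sign_gf_ends_with[of False j]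
    unfolding m[symmetric] gf a t by (simp add: m)
qed

end
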